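(* Let $PS=\{\alpha_1A_1\alpha_1^R,\ldots,\alpha_mA_m\alpha_m^R\}$ be a set of $m$ palindromic subcircuits. The procedure $PalindromeTransform(PS,m)$ produces an ordering of the $m$ circuits in $PS$ that maximizes, among all orderings, the total number of cancelling self-inverting gates (those cancelled in the overlaps between successive subcircuits of the concatenation).
   Context: Gates are treated as symbols of an alphabet, and circuits as strings of gates. A gate $A$ is self-inverting if $AA=I$. For a string $\alpha=A_1\ldots A_k$, $\alpha^R=A_k\ldots A_1$ is its reversal. A palindromic subcircuit is a string $\alpha\beta\alpha^R$ where $\alpha$ is a (possibly empty) string of self-inverting gates and $\beta$ is a unique gate, not necessarily self-inverting. "Unique" means: in a set $PS=\{\alpha_jA_j\alpha_j^R\}$ the middle gates $A_1,\ldots,A_m$ are pairwise distinct symbols and none of them occurs in any $\alpha_i$. A palindromic subcircuit is represented by its middle gate. The overlap of $\alpha_1A_1\alpha_1^R$ followed by $\alpha_2A_2\alpha_2^R$ is the longest prefix $\gamma$ of $\alpha_2$ such that $\gamma^R$ is a suffix of $\alpha_1^R$ (equivalently, the longest common prefix of $\alpha_1,\alpha_2$). In the concatenation, the $2\,length(\gamma)$ gates of $\gamma^R\gamma$ between $A_1$ and $A_2$ cancel. For an ordering $A_{j_1},\ldots,A_{j_m}$ of $PS$, the total number of cancelling self-inverting gates is the sum of these numbers $2\,length(\gamma)$ over the $m-1$ consecutive pairs. $PalindromeTransform(PS,m)$: insert the strings $\alpha_1A_1,\ldots,\alpha_mA_m$ one after another into an initially empty trie $T$ (root labeled by the empty string,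 each non-root node labeled by a gate; to insert a string, follow from the root the longest existing path spelling a prefix of it, then append a new path spelling the rest). The leaves of $T$ are then labeled $A_1,\ldots,A_m$. Output the leaf labels in the order in which the leaves are first encountered in a depth-first search of $T$ from the root. *)

theory Defs
  imports Main "HOL-Library.Sublist" "HOL-Library.Multiset"
begin

text \<open>
  Gates are symbols of an alphabet \<open>'g\<close> and circuits are lists of gates. The map
  \<open>sem\<close> sends a gate to the operation it performs, an element of some monoid;
  distinct symbols may denote the same operation.
\<close>

definition self_inverting :: "('g \<Rightarrow> 'u::monoid_mult) \<Rightarrow> 'g \<Rightarrow> bool" where
  "self_inverting sem A \<longleftrightarrow> sem A * sem A = 1"

text \<open>
  The family \<open>\<alpha>\<^sub>j A\<^sub>j \<alpha>\<^sub>j\<^sup>R\<close>, \<open>1 \<le> j \<le> m\<close>, is given by the strings \<open>\<alpha> j\<close> and the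
  middle gates \<open>A j\<close>.
\<close>

definition palindromic_subcircuits ::
  "('g \<Rightarrow> 'u::monoid_mult) \<Rightarrow> nat \<Rightarrow> (nat \<Rightarrow> 'g list) \<Rightarrow> (nat \<Rightarrow> 'g) \<Rightarrow> bool" where
  "palindromic_subcircuits sem m \<alpha> A \<longleftrightarrow>
     (\<forall>j\<in>{1..m}. \<forall>g\<in>set (\<alpha> j). self_inverting sem g) \<and>
     inj_on A {1..m} \<and>
     (\<forall>i\<in>{1..m}. \<forall>j\<in>{1..m}. A i \<notin> set (\<alpha> j))"

definition ordering_of :: "nat \<Rightarrow> nat list \<Rightarrow> bool" where
  "ordering_of m js \<longleftrightarrow> distinct js \<and> set js = {1..m}"

definition overlap :: "'g list \<Rightarrow> 'g list \<Rightarrow> 'g list" where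
  "overlap \<alpha>1 \<alpha>2 = arg_max length (\<lambda>\<gamma>. prefix \<gamma> \<alpha>2 \<and> suffix (rev \<gamma>) (rev \<alpha>1))"

definition cancelled :: "(nat \<Rightarrow> 'g list) \<Rightarrow> nat list \<Rightarrow> nat" where
  "cancelled \<alpha> js =
     (\<Sum>i<length js - 1. 2 * length (overlap (\<alpha> (js ! i)) (\<alpha> (js ! Suc i))))"

text \<open>The root carries the label \<open>None\<close> (the empty string), every other node a gate.\<close>

datatype 'g trie = Node (label: "'g option") (children: "'g trie list")

definition empty_trie :: "'g trie" where
  "empty_trie = Node None []"

fun new_path :: "'g list \<Rightarrow> 'g trie list" where
  "new_path [] = []"
| "new_path (x # xs) = [Node (Some x) (new_path xs)]"

text \<open>
  Siblings in a trie built from \<open>empty_trie\<close> by insertions have distinct labels, so the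
  first child with a matching label is the only one. The position at which a new child
  is added is irrelevant, since the search below may visit children in any order.
\<close>

fun insert_trie :: "'g list \<Rightarrow> 'g trie \<Rightarrow> 'g trie"
  and insert_children :: "'g list \<Rightarrow> 'g trie list \<Rightarrow> 'g trie list" where
  "insert_trie xs (Node l ts) = Node l (insert_children xs ts)"
| "insert_children [] ts = ts"
| "insert_children (x # xs) [] = new_path (x # xs)"
| "insert_children (x # xs) (t # ts) =
     (if label t = Some x then insert_trie xs t # ts
      else t # insert_children (x # xs) ts)"

definition build_trie :: "nat \<Rightarrow> (nat \<Rightarrow> 'g list) \<Rightarrow> (nat \<Rightarrow> 'g) \<Rightarrow> 'g trie" where
  "build_trie m \<alpha> A = fold (\<lambda>j. insert_trie (\<alpha> j @ [A j])) [1..<Suc m] empty_trie"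

text \<open>
  \<open>dfs t vs\<close>: some depth-first search of \<open>t\<close>, choosing the order \<open>ts'\<close> of the children
  freely at each node, first encounters the nodes (given by their subtrees) in the
  order \<open>vs\<close>.
\<close>

inductive dfs :: "'g trie \<Rightarrow> 'g trie list \<Rightarrow> bool" where
  "mset ts' = mset ts \<Longrightarrow> list_all2 dfs ts' vss \<Longrightarrow>
     dfs (Node l ts) (Node l ts # concat vss)"

text \<open>For \<open>m = 0\<close> the trie is a bare root, which carries no gate and so yields no output.\<close>

definition leaf_labels :: "'g trie list \<Rightarrow> 'g list" where
  "leaf_labels vs = [g. Node (Some g) [] \<leftarrow> vs]"

definition palindrome_transform ::
  "nat \<Rightarrow> (nat \<Rightarrow> 'g list) \<Rightarrow> (nat \<Rightarrow> 'g) \<Rightarrow> 'g list \<Rightarrow> bool" where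
  "palindrome_transform m \<alpha> A gs \<longleftrightarrow>
     (\<exists>vs. dfs (build_trie m \<alpha> A) vs \<and> gs = leaf_labels vs)"

end

theory Submission imports Defs begin

text \<open>
  The overlap of two strings has as many letters as there are nonempty strings \<open>p\<close> that are a
  prefix of both. Hence the number of cancelling gates is twice the sum, over all \<open>p\<close>, of the
  number of successive pairs whose members both start with \<open>p\<close>. If \<open>n > 0\<close> strings start
  with \<open>p\<close>, there are at most \<open>n - 1\<close> such pairs in any ordering, with equality if these
  strings are contiguous. A depth-first search visits the leaves below each node of the trie
  contiguously, so it attains all these bounds at once.
\<close>

section \<open>Sums over adjacent pairs\<close>

fun adjacent_sum :: "('a \<Rightarrow> 'a \<Rightarrow> nat) \<Rightarrow> 'a list \<Rightarrow> nat" where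
  "adjacent_sum f (x # y # zs) = f x y + adjacent_sum f (y # zs)"
| "adjacent_sum f _ = 0"

lemma adjacent_sum_nth:
  "adjacent_sum f xs = (\<Sum>i<length xs - 1. f (xs ! i) (xs ! Suc i))"
proof (induction f xs rule: adjacent_sum.induct)
  case (1 f x y zs)
  then show ?case
    by (simp add: sum.lessThan_Suc_shift del: sum.lessThan_Suc)
qed auto

abbreviation adjacent_count :: "('a \<Rightarrow> bool) \<Rightarrow> 'a list \<Rightarrow> nat" where
  "adjacent_count P \<equiv> adjacent_sum (\<lambda>x y. of_bool (P x \<and> P y))"

text \<open>Charge each counted pair to its second member: this entry satisfies \<open>P\<close> but
  is not the first to do so. Truncated subtraction covers the case of no such entry.\<close>

lemma adjacent_count_le: "adjacent_count P xs \<le> length (filter P xs) - 1"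
proof (induction "\<lambda>x y. of_bool (P x \<and> P y) :: nat" xs rule: adjacent_sum.induct)
  case (1 x y zs)
  then show ?case by (cases "P x"; cases "P y") auto
qed auto

text \<open>The block \<open>vs\<close> may be empty, so a list in which nothing satisfies
  \<open>P\<close> qualifies.\<close>

definition contiguous :: "('a \<Rightarrow> bool) \<Rightarrow> 'a list \<Rightarrow> bool" where
  "contiguous P xs \<longleftrightarrow> (\<exists>us vs ws. xs = us @ vs @ ws \<and>
     (\<forall>x\<in>set us \<union> set ws. \<not> P x) \<and> (\<forall>x\<in>set vs. P x))"

lemma contiguous_all: "\<forall>x\<in>set xs. P x \<Longrightarrow> contiguous P xs"
  unfolding contiguous_def by (rule exI[of _ "[]"], rule exI[of _ xs], rule exI[of _ "[]"]) simp

lemma contiguous_none: "\<forall>x\<in>set xs. \<not> P x \<Longrightarrow> contiguous P xs"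
  unfolding contiguous_def by (rule exI[of _ xs], rule exI[of _ "[]"], rule exI[of _ "[]"]) simp

lemma contiguous_singleton: "contiguous P [x]"
  by (cases "P x") (simp_all add: contiguous_all contiguous_none)

lemma contiguous_extend:
  assumes "contiguous P ys" "\<forall>x\<in>set xs \<union> set zs. \<not> P x"
  shows "contiguous P (xs @ ys @ zs)"
proof -
  obtain us vs ws where "ys = us @ vs @ ws" "\<forall>x\<in>set us \<union> set ws. \<not> P x" "\<forall>x\<in>set vs. P x"
    using assms(1) unfolding contiguous_def by blast
  then show ?thesis
    using assms(2) unfolding contiguous_def
    by (intro exI[of _ "xs @ us"] exI[of _ vs] exI[of _ "ws @ zs"]) auto
qed

text \<open>Serves to strip a common first letter from words, and to pass from an order of words to
  the order of their indices.\<close>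

lemma contiguous_map: "contiguous P (map f xs) \<longleftrightarrow> contiguous (P \<circ> f) xs"
proof
  assume "contiguous P (map f xs)"
  then obtain us' vs' ws' where split: "map f xs = us' @ vs' @ ws'"
    "\<forall>x\<in>set us' \<union> set ws'. \<not> P x" "\<forall>x\<in>set vs'. P x"
    unfolding contiguous_def by blast
  from split(1) obtain us vs ws where "xs = us @ vs @ ws"
    "us' = map f us" "vs' = map f vs" "ws' = map f ws"
    by (auto simp: map_eq_append_conv append_eq_map_conv)
  with split(2,3) show "contiguous (P \<circ> f) xs"
    unfolding contiguous_def
    by (intro exI[of _ us] exI[of _ vs] exI[of _ ws]) auto
next
  assume "contiguous (P \<circ> f) xs"
  then obtain us vs ws where "xs = us @ vs @ ws" "\<forall>x\<in>set us \<union> set ws. \<not> P (f x)"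
    "\<forall>x\<in>set vs. P (f x)"
    unfolding contiguous_def by auto
  then show "contiguous P (map f xs)"
    unfolding contiguous_def
    by (intro exI[of _ "map f us"] exI[of _ "map f vs"] exI[of _ "map f ws"]) auto
qed

text \<open>A nonempty block of n entries has n - 1 inner pairs, and every other pair has a member
  outside the block.\<close>

lemma adjacent_count_contiguous:
  assumes "contiguous P xs"
  shows "adjacent_count P xs = length (filter P xs) - 1"
proof -
  have none: "adjacent_count P ws = 0" if "\<forall>x\<in>set ws. \<not> P x" for ws
    using adjacent_count_le[of P ws] that by simp
  have block: "adjacent_count P (vs @ ws) = length vs - 1"
    if "\<forall>x\<in>set vs. P x" "\<forall>x\<in>set ws. \<not> P x" for vs ws
    using that
  proof (induction vs)
    case (Cons v vs)
    then show ?case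
      by (cases vs; cases ws) (auto simp: none)
  qed (simp add: none)
  have skip: "adjacent_count P (us @ ys) = adjacent_count P ys" if "\<forall>x\<in>set us. \<not> P x" for us ys
    using that
  proof (induction us)
    case (Cons u us)
    then show ?case by (cases "us @ ys") auto
  qed simp
  show ?thesis
    using assms unfolding contiguous_def by (auto simp: skip block)
qed

section \<open>Overlaps as common prefixes\<close>

text \<open>The overlap is the longest common prefix. Its nonempty prefixes, one for each positive
  length up to its own, are exactly the nonempty common prefixes.\<close>

lemma length_overlap:
  "length (overlap a b) = card {p. p \<noteq> [] \<and> prefix p a \<and> prefix p b}"
proof -
  let ?l = "longest_common_prefix a b"
  have common: "prefix p a \<and> prefix p b \<longleftrightarrow> prefix p ?l" for p
    using longest_common_prefix_max_prefix longest_common_prefix_prefix1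
      longest_common_prefix_prefix2 prefix_order.trans by metis
  have "length (overlap a b) = length ?l"
    unfolding overlap_def
    by (rule arg_max_equality)
      (auto simp: suffix_to_prefix longest_common_prefix_prefix1 longest_common_prefix_prefix2
        intro!: prefix_length_le longest_common_prefix_max_prefix)
  moreover have "{p. p \<noteq> [] \<and> prefix p a \<and> prefix p b} = set (prefixes ?l) - {[]}"
    by (auto simp: common)
  moreover have "card (set (prefixes ?l) - {[]}) = length ?l"
    by (simp add: distinct_card)
  ultimately show ?thesis by simp
qed

section \<open>Tries\<close>

text \<open>The stored words, each read down to a leaf. A childless \<open>None\<close> root
  contributes none, so the empty trie stores no word.\<close>

fun paths :: "'g trie \<Rightarrow> 'g list list" where
  "paths (Node None ts) = concat (map paths ts)"
| "paths (Node (Some g) ts) = (if ts = [] then [[g]] else map ((#) g) (concat (map paths ts)))"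

text \<open>The root may be labelled \<open>None\<close>, but no other node.\<close>

fun wf_trie :: "'g trie \<Rightarrow> bool" where
  "wf_trie (Node l ts) \<longleftrightarrow>
     distinct (map label ts) \<and> (\<forall>t\<in>set ts. label t \<noteq> None \<and> wf_trie t)"

lemma paths_nonempty: "wf_trie t \<Longrightarrow> label t \<noteq> None \<Longrightarrow> paths t \<noteq> []"
proof (induction t)
  case (Node l ts)
  then show ?case by (cases ts) auto
qed

lemma paths_start: "w \<in> set (paths t) \<Longrightarrow> label t = Some g \<Longrightarrow> \<exists>v. w = g # v"
  by (cases t) (auto split: if_splits)

lemma new_path_wf: "\<forall>t\<in>set (new_path w). label t \<noteq> None \<and> wf_trie t"
  by (induction w rule: new_path.induct) (auto, (case_tac xs; simp)+)

lemma paths_new_path: "w \<noteq> [] \<Longrightarrow> concat (map paths (new_path w)) = [w]"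
proof (induction w rule: new_path.induct)
  case (2 x xs)
  then show ?case by (cases xs) auto
qed simp

lemma label_insert_trie [simp]: "label (insert_trie w t) = label t"
  by (cases t) simp

text \<open>Keeps sibling labels distinct: insertion passes over a child only if its label differs
  from the first letter, so that label cannot reappear further on.\<close>

lemma labels_insert_children:
  "label ` set (insert_children w ts) \<subseteq> label ` set ts \<union> (case w of [] \<Rightarrow> {} | x # xs \<Rightarrow> {Some x})"
  by (induction ts) (cases w; auto)+

lemma wf_insert:
  "wf_trie t \<Longrightarrow> wf_trie (insert_trie w t)"
  "wf_trie (Node l ts) \<Longrightarrow> wf_trie (Node l (insert_children w ts))"
proof (induction w t and w ts rule: insert_trie_insert_children.induct)
  case (3 x xs)
  then show ?case using new_path_wf[of "x # xs"] by simp
next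
  case (4 x xs t ts)
  then show ?case
    using labels_insert_children[of "x # xs" ts] by (auto simp: image_iff)
qed auto

text \<open>
  Prefix-freeness matters: inserting an extension of a stored string would turn its leaf into an
  inner node, and inserting a prefix of one would not create a leaf.
\<close>

lemma paths_insert:
  "\<lbrakk>wf_trie t; label t = Some g; \<forall>v\<in>set (paths t). g # w \<parallel> v\<rbrakk>
    \<Longrightarrow> mset (paths (insert_trie w t)) = add_mset (g # w) (mset (paths t))"
  "\<lbrakk>wf_trie (Node None ts); w \<noteq> []; \<forall>v\<in>set (concat (map paths ts)). w \<parallel> v\<rbrakk>
    \<Longrightarrow> mset (concat (map paths (insert_children w ts))) =
        add_mset w (mset (concat (map paths ts)))"
proof (induction w t and w ts arbitrary: g rule: insert_trie_insert_children.induct)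
  case (1 w l ts)
  have l: "l = Some g" using 1 by simp
  \<comment> \<open>A leaf would store just \<open>[g]\<close>, which is a prefix of
    \<open>g # w\<close>.\<close>
  have ts: "ts \<noteq> []" using 1(4) l by (auto simp: parallel_def)
  have par: "\<forall>v\<in>set (concat (map paths ts)). w \<parallel> v"
    using 1(4) l ts by (auto simp: parallel_def)
  \<comment> \<open>The empty string is comparable with every word, so the children would store
    nothing, whereas each well-formed labelled child stores some word.\<close>
  have w: "w \<noteq> []"
  proof
    assume "w = []"
    then have "concat (map paths ts) = []"
      using par by (metis last_in_set parallelD1 Nil_prefix)
    moreover have "paths (hd ts) \<noteq> []"
      using 1(2) hd_in_set[OF ts] paths_nonempty by (metis wf_trie.simps)
    ultimately show False
      using ts by (metis concat.simps(2) append_is_Nil_conv list.exhaust_sel list.simps(9))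
  qed
  have "mset (concat (map paths (insert_children w ts))) =
        add_mset w (mset (concat (map paths ts)))"
    using 1(1)[OF _ w par] 1(2) by simp
  \<comment> \<open>This selects the inner-node branch of \<open>paths\<close> after the insertion
    as well.\<close>
  moreover from this have "insert_children w ts \<noteq> []" by auto
  ultimately show ?case using l ts by (simp del: mset_concat)
next
  case (2 ts)
  then show ?case by simp
next
  case (3 x xs)
  then show ?case using paths_new_path[of "x # xs"] by (simp del: new_path.simps)
next
  case (4 x xs t ts)
  show ?case
  proof (cases "label t = Some x")
    case True
    then show ?thesis using 4(1)[OF True _ True] 4(3,5) by simp
  next
    case False
    then show ?thesis using 4(2)[OF False] 4(3,5) by simp
  qed
qed

text \<open>Distinctness and pairwise incomparability supply the prefix-freeness hypothesis at each
  insertion. Induction from the right fits \<open>fold\<close>, which inserts the last word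
  last.\<close>

lemma fold_insert_trie:
  assumes "distinct ws" "\<forall>u\<in>set ws. \<forall>v\<in>set ws. u \<noteq> v \<longrightarrow> u \<parallel> v" "[] \<notin> set ws"
  shows "\<exists>ts. fold insert_trie ws empty_trie = Node None ts \<and> wf_trie (Node None ts) \<and>
    mset (paths (Node None ts)) = mset ws"
  using assms
proof (induction ws rule: rev_induct)
  case Nil
  then show ?case by (simp add: empty_trie_def)
next
  case (snoc w ws)
  then obtain ts where ts: "fold insert_trie ws empty_trie = Node None ts"
    "wf_trie (Node None ts)" "mset (paths (Node None ts)) = mset ws"
    by auto
  have "set (concat (map paths ts)) = set ws"
    using mset_eq_setD[OF ts(3)] by simp
  then have "\<forall>v\<in>set (concat (map paths ts)). w \<parallel> v" using snoc.prems by auto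
  then have "mset (concat (map paths (insert_children w ts))) =
      add_mset w (mset (concat (map paths ts)))"
    using paths_insert(2)[OF ts(2)] snoc.prems(3) by auto
  then show ?case
    using ts wf_insert(2)[OF ts(2)] by (simp del: mset_concat wf_trie.simps)
qed

section \<open>Depth-first search\<close>

text \<open>Keeping the stored order of the children at every node gives a search.\<close>

lemma dfs_exists: "\<exists>vs. dfs t vs"
proof (induction t)
  case (Node l ts)
  then obtain f where "\<forall>t\<in>set ts. dfs t (f t)" by metis
  then have "list_all2 dfs ts (map f ts)"
    by (simp add: list_all2_conv_all_nth)
  then show ?case using dfs.intros by blast
qed

lemma leaf_labels_append: "leaf_labels (us @ vs) = leaf_labels us @ leaf_labels vs"
  by (simp add: leaf_labels_def)

lemma leaf_labels_concat: "leaf_labels (concat vss) = concat (map leaf_labels vss)"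
  by (induction vss) (simp_all add: leaf_labels_append, simp add: leaf_labels_def)

lemma leaf_labels_Cons:
  "leaf_labels (Node l ts # vs) =
     (case l of Some g \<Rightarrow> if ts = [] then [g] else [] | None \<Rightarrow> []) @ leaf_labels vs"
  by (cases l; cases ts) (auto simp: leaf_labels_def)

text \<open>The blocks have distinct first letters, so a nonempty \<open>p\<close> can match words
  of one block only; the other blocks merely pad it. Every word starts with the empty
  string.\<close>

lemma contiguous_concat_blocks:
  assumes "distinct (map label ts)"
    and "list_all2 (\<lambda>t ws. \<exists>g. label t = Some g \<and> (\<forall>w\<in>set ws. \<exists>v. w = g # v) \<and>
           (\<forall>p. contiguous (prefix p) ws)) ts wss"
  shows "contiguous (prefix p) (concat wss)"
proof (cases p)
  case Nil
  then show ?thesis by (simp add: contiguous_all)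
next
  case (Cons x q)
  from assms(2,1) show ?thesis
  proof (induction rule: list_all2_induct)
    case Nil
    then show ?case by (simp add: contiguous_none)
  next
    case (Cons t ts ws wss)
    then obtain g where g: "label t = Some g" "\<forall>w\<in>set ws. \<exists>v. w = g # v"
      "contiguous (prefix p) ws" by blast
    show ?case
    proof (cases "g = x")
      case True
      have "\<not> prefix p w" if w: "w \<in> set (concat wss)" for w
      proof -
        obtain i where i: "i < length wss" "w \<in> set (wss ! i)"
          using w by (metis UN_E in_set_conv_nth set_concat)
        then have "i < length ts" using Cons.hyps(2) by (simp add: list_all2_lengthD)
        obtain h v where "label (ts ! i) = Some h" "w = h # v"
          using list_all2_nthD2[OF Cons.hyps(2) i(1)] i(2) by blast
        moreover from \<open>i < length ts\<close> have "label (ts ! i) \<noteq> label t"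
          using Cons.prems nth_mem
          by (metis distinct.simps(2) image_eqI list.set_map list.simps(9))
        ultimately show ?thesis using g(1) True \<open>p = x # q\<close> by auto
      qed
      then show ?thesis
        using contiguous_extend[OF g(3), of "[]" "concat wss"] by simp
    next
      case False
      then have "\<forall>w\<in>set ws. \<not> prefix p w" using g(2) \<open>p = x # q\<close> by auto
      then show ?thesis
        using contiguous_extend[of "prefix p" "concat wss" ws "[]"] Cons by simp
    qed
  qed
qed

text \<open>For \<open>p = x # q\<close>, either \<open>x = g\<close> and the claim reduces to
  \<open>q\<close>, or no word starts with \<open>p\<close>.\<close>

lemma contiguous_Cons:
  assumes "\<And>p. contiguous (prefix p) ws"
  shows "contiguous (prefix p) (map ((#) g) ws)"
proof (cases p)
  case Nil
  then show ?thesis by (simp add: contiguous_all)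
next
  case (Cons x q)
  then show ?thesis
    using assms[of q]
    by (cases "x = g") (auto simp: contiguous_map comp_def intro: contiguous_none)
qed

text \<open>The witness \<open>ws\<close> lists the stored words in the order in which the search
  meets their leaves; the last letter of a word is the label of its leaf.\<close>

lemma dfs_leaves:
  fixes t :: "'a trie"
  assumes "dfs t vs" "wf_trie t"
  shows "\<exists>ws. mset ws = mset (paths t) \<and> (\<forall>p. contiguous (prefix p) ws) \<and>
    leaf_labels vs = map last ws"
  using assms
proof (induction rule: dfs.induct)
  case (1 ts' ts vss l)
  have set_ts: "set ts' = set ts" using 1(1) by (rule mset_eq_setD)
  \<comment> \<open>\<open>R\<close> is the claim for one subtree, its part of the search and its
    words; it allows choosing words for all children at once.\<close>
  define R where "R = (\<lambda>(t :: 'a trie) vs ws. mset ws = mset (paths t) \<and>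
    (\<forall>p. contiguous (prefix p) ws) \<and> leaf_labels vs = map last ws)"
  have len: "length vss = length ts'" using 1(2) by (simp add: list_all2_lengthD)
  have "\<forall>i<length ts'. \<exists>ws. R (ts' ! i) (vss ! i) ws"
    using 1(2,3) set_ts unfolding R_def by (fastforce simp: list_all2_conv_all_nth)
  then obtain f where f: "\<forall>i<length ts'. R (ts' ! i) (vss ! i) (f i)" by metis
  define wss where "wss = map f [0..<length ts']"
  have wss: "length wss = length ts'" "\<forall>i<length ts'. R (ts' ! i) (vss ! i) (wss ! i)"
    using f by (simp_all add: wss_def)
  let ?ws = "concat wss"
  have "map mset wss = map (mset \<circ> paths) ts'"
    using wss by (auto intro!: nth_equalityI simp: R_def)
  then have "mset ?ws = sum_list (map (mset \<circ> paths) ts')"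
    by (simp add: mset_concat)
  also have "\<dots> = sum_list (map (mset \<circ> paths) ts)"
    using 1(1) by (metis mset_map sum_mset_sum_list)
  finally have mset_ws: "mset ?ws = mset (concat (map paths ts))"
    by (simp add: mset_concat)
  have "distinct (map label ts)" using 1(3) by simp
  then have "distinct (map label ts')"
    by (metis 1(1) mset_eq_imp_distinct_iff mset_map)
  moreover have "list_all2 (\<lambda>t ws. \<exists>g. label t = Some g \<and> (\<forall>w\<in>set ws. \<exists>v. w = g # v) \<and>
           (\<forall>p. contiguous (prefix p) ws)) ts' wss"
    unfolding list_all2_conv_all_nth
  proof (intro conjI allI impI)
    fix i assume i: "i < length ts'"
    then obtain g where g: "label (ts' ! i) = Some g"
      using 1(3) set_ts nth_mem by fastforce
    have R: "R (ts' ! i) (vss ! i) (wss ! i)" using wss(2) i by blast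
    then have "set (wss ! i) = set (paths (ts' ! i))"
      unfolding R_def using mset_eq_setD by blast
    then show "\<exists>g. label (ts' ! i) = Some g \<and> (\<forall>w\<in>set (wss ! i). \<exists>v. w = g # v) \<and>
           (\<forall>p. contiguous (prefix p) (wss ! i))"
      using g R paths_start unfolding R_def by fastforce
  qed (simp add: wss(1))
  ultimately have cont: "\<And>p. contiguous (prefix p) ?ws"
    using contiguous_concat_blocks by blast
  have "map leaf_labels vss = map (map last) wss"
    using wss len by (auto intro!: nth_equalityI simp: R_def)
  then have labels: "leaf_labels (concat vss) = map last ?ws"
    by (simp add: leaf_labels_concat map_concat)
  show ?case
  proof (cases l)
    case None
    then show ?thesis using mset_ws cont labels
      by (intro exI[of _ ?ws]) (simp add: leaf_labels_Cons)
  next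
    case (Some g)
    show ?thesis
    proof (cases "ts = []")
      case True
      then have "?ws = []" using mset_ws by simp
      then show ?thesis using Some True labels
        by (intro exI[of _ "[[g]]"])
          (simp add: leaf_labels_Cons contiguous_singleton)
    next
      case False
      \<comment> \<open>Prepending \<open>g\<close> preserves the last letter only of nonempty
        words.\<close>
      have "w \<noteq> []" if w: "w \<in> set ?ws" for w
      proof -
        obtain t where t: "t \<in> set ts" "w \<in> set (paths t)"
          using w unfolding mset_eq_setD[OF mset_ws] by auto
        then obtain h where h: "label t = Some h" using 1(3) by auto
        show ?thesis using paths_start[OF t(2) h] by auto
      qed
      then have "map last (map ((#) g) ?ws) = map last ?ws" by simp
      then show ?thesis using Some False labels mset_ws contiguous_Cons[OF cont, of _ g]
        by (intro exI[of _ "map ((#) g) ?ws"]) (simp add: leaf_labels_Cons del: mset_concat)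
    qed
  qed
qed

section \<open>Optimality\<close>

theorem corollary1:
  fixes sem :: "'g \<Rightarrow> 'u::monoid_mult"
    and \<alpha> :: "nat \<Rightarrow> 'g list" and A :: "nat \<Rightarrow> 'g" and m :: nat
  assumes "palindromic_subcircuits sem m \<alpha> A"
  shows "(\<exists>gs. palindrome_transform m \<alpha> A gs) \<and>
    (\<forall>gs. palindrome_transform m \<alpha> A gs \<longrightarrow>
      (\<exists>js. ordering_of m js \<and> gs = map A js \<and>
        (\<forall>js'. ordering_of m js' \<longrightarrow> cancelled \<alpha> js' \<le> cancelled \<alpha> js)))"
proof (intro conjI allI impI)
  show "\<exists>gs. palindrome_transform m \<alpha> A gs"
    unfolding palindrome_transform_def using dfs_exists by blast
next
  fix gs assume "palindrome_transform m \<alpha> A gs"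
  then obtain vs where vs: "dfs (build_trie m \<alpha> A) vs" "gs = leaf_labels vs"
    unfolding palindrome_transform_def by blast
  \<comment> \<open>The middle gates make the inserted words prefix-free without changing the common
    prefixes of two different strings \<alpha>.\<close>
  define w where "w j = \<alpha> j @ [A j]" for j
  have inj: "inj_on A {1..m}" and fresh: "\<And>i j. i \<in> {1..m} \<Longrightarrow> j \<in> {1..m} \<Longrightarrow> A i \<notin> set (\<alpha> j)"
    using assms unfolding palindromic_subcircuits_def by auto
  have A_notin: "A i \<notin> set (w j)" if "i \<in> {1..m}" "j \<in> {1..m}" "i \<noteq> j" for i j
    using fresh[OF that(1,2)] inj_on_eq_iff[OF inj that(1,2)] that(3) by (simp add: w_def)
  \<comment> \<open>The last gate of \<open>w i\<close> does not occur in
    \<open>w j\<close>.\<close>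
  have not_prefix: "\<not> prefix (w i) (w j)" if "i \<in> {1..m}" "j \<in> {1..m}" "i \<noteq> j" for i j
    using A_notin[OF that] set_mono_prefix[of "w i" "w j"] by (auto simp: w_def)
  have inj_w: "inj_on w {1..m}"
    using not_prefix unfolding inj_on_def by (metis prefix_order.refl)
  \<comment> \<open>A common prefix reaching a middle gate would be one whole word, hence a prefix
    of the other.\<close>
  have common_prefix: "prefix p (\<alpha> i) \<and> prefix p (\<alpha> j) \<longleftrightarrow> prefix p (w i) \<and> prefix p (w j)"
    if "i \<in> {1..m}" "j \<in> {1..m}" "i \<noteq> j" for i j p
    using not_prefix[OF that] not_prefix[OF that(2,1) that(3)[symmetric]]
    by (auto simp: w_def)
  define ks where "ks = [1..<Suc m]"
  have set_ks: "set ks = {1..m}" "distinct ks" by (auto simp: ks_def)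
  have build: "build_trie m \<alpha> A = fold insert_trie (map w ks) empty_trie"
    by (simp add: build_trie_def ks_def w_def fold_map comp_def)
  have "distinct (map w ks)" using inj_w set_ks by (simp add: distinct_map)
  moreover have "\<forall>u\<in>set (map w ks). \<forall>v\<in>set (map w ks). u \<noteq> v \<longrightarrow> u \<parallel> v"
    unfolding set_map set_ks parallel_def using not_prefix by blast
  moreover have "[] \<notin> set (map w ks)" by (auto simp: w_def)
  ultimately obtain ts where ts: "build_trie m \<alpha> A = Node None ts" "wf_trie (Node None ts)"
    "mset (paths (Node None ts)) = mset (map w ks)"
    unfolding build by (meson fold_insert_trie)
  obtain ws where ws: "mset ws = mset (map w ks)"
    "\<And>p. contiguous (prefix p) ws" "gs = map last ws"
    using dfs_leaves[OF vs(1)[unfolded ts(1)] ts(2)] unfolding vs(2) ts(3) by blast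
  \<comment> \<open>Injectivity of \<open>w\<close> recovers the index of each word in the order of
    the search.\<close>
  define js where "js = map (the_inv_into {1..m} w) ws"
  have "set ws = w ` {1..m}" using mset_eq_setD[OF ws(1)] set_ks by simp
  then have ws_js: "ws = map w js"
    unfolding js_def map_map by (intro map_idI[symmetric]) (simp only: comp_def f_the_inv_into_f[OF inj_w])
  have "mset js = mset (map (the_inv_into {1..m} w) (map w ks))"
    unfolding js_def by (metis ws(1) mset_map)
  also have "map (the_inv_into {1..m} w) (map w ks) = ks"
    unfolding map_map by (intro map_idI) (simp only: set_ks comp_def the_inv_into_f_f[OF inj_w])
  finally have mset_js: "mset js = mset ks" .
  then have ordering: "ordering_of m js"
    unfolding ordering_of_def using set_ks by (metis mset_eq_setD mset_eq_imp_distinct_iff)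
  \<comment> \<open>A finite index set containing every nonempty common prefix that can
    occur.\<close>
  define P where "P = (\<Union>j\<in>{1..m}. set (prefixes (\<alpha> j))) - {[]}"
  have finite_P: "finite P" unfolding P_def by simp
  have len_overlap: "length (overlap (\<alpha> i) (\<alpha> j)) =
      (\<Sum>p\<in>P. of_bool (prefix p (w i) \<and> prefix p (w j)))"
    if ij: "i \<in> {1..m}" "j \<in> {1..m}" "i \<noteq> j" for i j
  proof -
    have "{p. p \<noteq> [] \<and> prefix p (\<alpha> i) \<and> prefix p (\<alpha> j)} =
      {p \<in> P. prefix p (w i) \<and> prefix p (w j)}"
      unfolding common_prefix[OF ij, symmetric] using ij(1) by (auto simp: P_def)
    then show ?thesis
      unfolding length_overlap using finite_P by (simp add: Int_def)
  qed
  have cancelled_eq: "cancelled \<alpha> is = 2 * (\<Sum>p\<in>P. adjacent_count (\<lambda>j. prefix p (w j)) is)"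
    if "ordering_of m is" for "is"
  proof -
    have "cancelled \<alpha> is = (\<Sum>i<length is - 1. 2 *
        (\<Sum>p\<in>P. of_bool (prefix p (w (is ! i)) \<and> prefix p (w (is ! Suc i)))))"
      unfolding cancelled_def
    proof (rule sum.cong)
      fix i assume "i \<in> {..<length is - 1}"
      then have i: "i < length is" "Suc i < length is" by auto
      then have "is ! i \<in> {1..m}" "is ! Suc i \<in> {1..m}" "is ! i \<noteq> is ! Suc i"
        using that nth_mem[OF i(1)] nth_mem[OF i(2)] nth_eq_iff_index_eq[OF _ i]
        unfolding ordering_of_def by simp_all
      from len_overlap[OF this] show "2 * length (overlap (\<alpha> (is ! i)) (\<alpha> (is ! Suc i))) = 2 *
        (\<Sum>p\<in>P. of_bool (prefix p (w (is ! i)) \<and> prefix p (w (is ! Suc i))))"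
        by (rule arg_cong)
    qed simp
    \<comment> \<open>Interchanging the sums counts pairs for each prefix separately.\<close>
    also have "\<dots> = 2 * (\<Sum>p\<in>P. adjacent_count (\<lambda>j. prefix p (w j)) is)"
      unfolding adjacent_sum_nth sum_distrib_left[symmetric] by (subst sum.swap) simp
    finally show ?thesis .
  qed
  have optimal: "cancelled \<alpha> js' \<le> cancelled \<alpha> js" if js': "ordering_of m js'" for js'
  proof -
    \<comment> \<open>Any two orderings have equally many words starting with a given prefix, so the
      bound on each summand is the same for both, and \<open>js\<close> attains it.\<close>
    have "mset js' = mset js"
      using js' ordering unfolding ordering_of_def by (metis set_eq_iff_mset_eq_distinct)
    then have "length (filter Q js') = length (filter Q js)" for Q
      by (metis mset_filter size_mset)
    moreover have "contiguous (\<lambda>j. prefix p (w j)) js" for p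
      using ws(2)[of p] unfolding ws_js contiguous_map by (simp add: comp_def)
    ultimately have "adjacent_count (\<lambda>j. prefix p (w j)) js' \<le>
        adjacent_count (\<lambda>j. prefix p (w j)) js" for p
      by (metis adjacent_count_le adjacent_count_contiguous)
    then show ?thesis
      unfolding cancelled_eq[OF js'] cancelled_eq[OF ordering] by (simp add: sum_mono)
  qed
  have "gs = map A js" using ws(3) unfolding ws_js by (simp add: w_def)
  then show "\<exists>js. ordering_of m js \<and> gs = map A js \<and>
        (\<forall>js'. ordering_of m js' \<longrightarrow> cancelled \<alpha> js' \<le> cancelled \<alpha> js)"
    using ordering optimal by blast
qed

end
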